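(* Let $G$ be a graph on $n$ vertices and let $C$ be a longest cycle in $G$, of length $c$, where $4\leq c\leq n-1$. If $e(G-V(C))+e(G-V(C),V(C))>(\lfloor c/2\rfloor-1)(n-c)$, then one of the following holds: (a) $c\in\{6,7,9\}$; (b) there exists a vertex $u\notin V(C)$ with exactly $\lfloor c/2\rfloor$ neighbors in $V(C)$; (c) there exists a cycle $C'$ in $G$ with $|V(C)\cap V(C')|\leq 1$ such that $|C'|\geq 2\lfloor c/2\rfloor-3$ if $V(C)\cap V(C')=\emptyset$, and $|C'|\geq 2\lfloor c/2\rfloor-1$ if $|V(C)\cap V(C')|=1$.
   Context: Graphs are simple and finite. $|C'|$ denotes the length (number of vertices) of the cycle $C'$. $e(G-V(C),V(C))$ is the number of edges with exactly one endpoint in $V(C)$. *)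

theory Defs
  imports Main
begin

definition simple_graph :: "'a set \<Rightarrow> 'a set set \<Rightarrow> bool" where
  "simple_graph V E \<longleftrightarrow> finite V \<and> (\<forall>e\<in>E. e \<subseteq> V \<and> card e = 2)"

text \<open>A cycle is given by the list of its vertices in cyclic order (each vertex listed once), so
  that \<open>set xs\<close> is its vertex set and \<open>length xs\<close> its length.\<close>

definition is_cycle :: "'a set \<Rightarrow> 'a set set \<Rightarrow> 'a list \<Rightarrow> bool" where
  "is_cycle V E xs \<longleftrightarrow> 3 \<le> length xs \<and> distinct xs \<and> set xs \<subseteq> V \<and>
     (\<forall>i<length xs. {xs ! i, xs ! (Suc i mod length xs)} \<in> E)"

definition longest_cycle :: "'a set \<Rightarrow> 'a set set \<Rightarrow> 'a list \<Rightarrow> bool" where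
  "longest_cycle V E xs \<longleftrightarrow> is_cycle V E xs \<and> (\<forall>ys. is_cycle V E ys \<longrightarrow> length ys \<le> length xs)"

definition edges_within :: "'a set set \<Rightarrow> 'a set \<Rightarrow> 'a set set" where
  "edges_within E A = {e \<in> E. e \<subseteq> A}"

definition edges_between :: "'a set set \<Rightarrow> 'a set \<Rightarrow> 'a set \<Rightarrow> 'a set set" where
  "edges_between E A B = {e \<in> E. \<exists>a\<in>A. \<exists>b\<in>B. e = {a, b}}"

definition neighbors_in :: "'a set set \<Rightarrow> 'a \<Rightarrow> 'a set \<Rightarrow> 'a set" where
  "neighbors_in E u A = {v \<in> A. {u, v} \<in> E}"

end

theory Submission
  imports Defs
begin

text \<open>
  Write $k$ for half the length of $C$, rounded down. A minimal set $D$ of vertices outside $C$ that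
  is incident with more than $(k-1)|D|$ edges of the graph induced on $D$ and $C$ has the property
  that each of its nonempty subsets $S$ is incident with more than $(k-1)|S|$ of these edges. Let
  $P$ be a longest path in $D$, with $p$ vertices. As $C$ is longest, a neighbour on $C$ of one end
  of $P$ is at distance at least $p+1$ along $C$ from every other vertex that is a neighbour of the
  opposite end. If both ends have neighbours on $C$, and together at least two, counting these gaps
  against the degrees (at least $k$) forces $C$ to have length 6, 7 or 9. Otherwise there is a
  vertex $z$ such that every longest path in $D$ from $z$ ends in a vertex with at most one
  neighbour on $C$. Rotate such a path, keeping $z$ fixed, and let $t$ be the largest number of
  vertices cut off by a chord from the other end. For an end with maximal degree $a$ in $D$, the
  rotations produce a set $S$ of $a$ ends whose neighbours in $D$ lie in the cut-off part, so
  $S$ is incident with at most $at/2 + a$ edges. Hence $t \ge 2k-3$, and the chord closes a cycle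
  in $D$. (If $k = 2$ this could degenerate to $t = 2$; then the path together with the common
  neighbour of its ends on $C$ is the required cycle.)
\<close>

section \<open>Paths, rotations, and cycles closed by a chord\<close>

definition graph_path :: "'a set set \<Rightarrow> 'a set \<Rightarrow> 'a list \<Rightarrow> bool" where
  "graph_path E D xs \<longleftrightarrow> xs \<noteq> [] \<and> distinct xs \<and> set xs \<subseteq> D
     \<and> successively (\<lambda>x y. {x, y} \<in> E) xs"

lemma graph_path_rev: "graph_path E D xs \<Longrightarrow> graph_path E D (rev xs)"
  by (simp add: graph_path_def insert_commute)

text \<open>Posa rotation: the chord from the first vertex to \<open>xs ! i\<close> replaces the
  path edge between \<open>xs ! (i - 1)\<close> and \<open>xs ! i\<close>. For \<open>i = 1\<close>
  chord and path edge coincide and the path does not change.\<close>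

lemma graph_path_rotate:
  assumes "graph_path E D xs" "0 < i" "i < length xs" "{hd xs, xs ! i} \<in> E"
  shows "graph_path E D (rev (take i xs) @ drop i xs)"
    and "hd (rev (take i xs) @ drop i xs) = xs ! (i - 1)"
    and "last (rev (take i xs) @ drop i xs) = last xs"
    and "set (rev (take i xs) @ drop i xs) = set xs"
    and "length (rev (take i xs) @ drop i xs) = length xs"
proof -
  have split: "take i xs @ drop i xs = xs" by simp
  have suc: "successively (\<lambda>x y. {x, y} \<in> E) (take i xs)"
    "successively (\<lambda>x y. {x, y} \<in> E) (drop i xs)"
    using assms(1) split unfolding graph_path_def by (metis successively_append_iff)+
  show seteq: "set (rev (take i xs) @ drop i xs) = set xs"
    by (metis set_append set_rev split)
  show len: "length (rev (take i xs) @ drop i xs) = length xs" by simp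
  have dist: "distinct (rev (take i xs) @ drop i xs)"
    using seteq len assms(1) unfolding graph_path_def by (metis card_distinct distinct_card)
  have ne: "take i xs \<noteq> []" "drop i xs \<noteq> []" using assms by auto
  have "last (rev (take i xs)) = hd xs" using ne assms by (simp add: last_rev)
  moreover have "hd (drop i xs) = xs ! i" using assms by (simp add: hd_drop_conv_nth)
  ultimately show "graph_path E D (rev (take i xs) @ drop i xs)"
    using suc dist seteq assms ne
    by (auto simp: graph_path_def successively_append_iff insert_commute simp del: set_append)
  show "hd (rev (take i xs) @ drop i xs) = xs ! (i - 1)"
    using assms ne by (simp add: hd_append hd_rev last_conv_nth)
  show "last (rev (take i xs) @ drop i xs) = last xs"
    using ne by simp
qed

lemma is_cycle_of_path:
  assumes "graph_path E V xs" "3 \<le> length xs" "{last xs, hd xs} \<in> E"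
  shows "is_cycle V E xs"
  unfolding is_cycle_def
proof (intro conjI allI impI)
  fix i assume i: "i < length xs"
  show "{xs ! i, xs ! (Suc i mod length xs)} \<in> E"
  proof (cases "Suc i < length xs")
    case True
    then show ?thesis
      using assms(1) by (simp add: graph_path_def successively_conv_nth)
  next
    case False
    with i have "i = length xs - 1" by simp
    moreover have "xs \<noteq> []" using i by auto
    ultimately show ?thesis
      using assms(3) by (simp add: last_conv_nth hd_conv_nth)
  qed
qed (use assms in \<open>auto simp: graph_path_def\<close>)

section \<open>Gaps along a longest cycle\<close>

text \<open>Directed distance: the number of forward steps from position \<open>i\<close> to
  position \<open>j\<close> around a cycle of \<open>c\<close> positions. For distinct positions the
  two directions add up to \<open>c\<close>.\<close>

definition cyc_dist :: "nat \<Rightarrow> nat \<Rightarrow> nat \<Rightarrow> nat" where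
  "cyc_dist c i j = (if i \<le> j then j - i else c + j - i)"

text \<open>Replacing the inner vertices of the arc from \<open>C ! i\<close> forward to
  \<open>C ! j\<close> by \<open>xs\<close> yields a cycle, which is no longer than
  \<open>C\<close>. So this arc has at least \<open>length xs\<close> inner vertices.\<close>

lemma cycle_gap:
  assumes "longest_cycle V E C" "graph_path E (V - set C) xs"
    and "i < length C" "j < length C" "i \<noteq> j"
    and "{hd xs, C ! i} \<in> E" "{last xs, C ! j} \<in> E"
  shows "length xs + 1 \<le> cyc_dist (length C) i j"
proof -
  define c where "c = length C"
  \<comment> \<open>The new cycle keeps the complementary arc, from \<open>j\<close> forward to
    \<open>i\<close>; it has \<open>d\<close> edges and therefore \<open>Suc d\<close>
    vertices.\<close>
  define d where "d = cyc_dist c j i"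
  define arc where "arc = map (\<lambda>t. C ! ((j + t) mod c)) [0..<Suc d]"
  have cyc: "is_cycle V E C" and max: "\<And>ys. is_cycle V E ys \<Longrightarrow> length ys \<le> c"
    using assms(1) by (auto simp: longest_cycle_def c_def)
  have ij: "i < c" "j < c" using assms by (auto simp: c_def)
  have d: "d < c" "0 < d" "(j + d) mod c = i"
    using ij assms(5) by (auto simp: d_def cyc_dist_def)
  have inj: "inj_on (\<lambda>t. (j + t) mod c) {0..<Suc d}"
  proof (rule inj_onI)
    fix s t assume st: "s \<in> {0..<Suc d}" "t \<in> {0..<Suc d}" "(j + s) mod c = (j + t) mod c"
    have red: "(j + u) mod c = (if j + u < c then j + u else j + u - c)" if "u < c" for u
      using that ij by (simp add: mod_if)
    show "s = t"
      using st d ij red[of s] red[of t] by (auto split: if_splits)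
  qed
  have distC: "distinct C" using cyc by (simp add: is_cycle_def)
  have "inj_on (\<lambda>t. C ! ((j + t) mod c)) {0..<Suc d}"
  proof (rule inj_onI)
    fix s t assume st: "s \<in> {0..<Suc d}" "t \<in> {0..<Suc d}"
      "C ! ((j + s) mod c) = C ! ((j + t) mod c)"
    have "(j + u) mod c < length C" for u using ij by (simp add: c_def[symmetric])
    then have "(j + s) mod c = (j + t) mod c"
      using st(3) distC nth_eq_iff_index_eq by metis
    with st inj show "s = t" by (meson inj_onD)
  qed
  then have arc_dist: "distinct arc" by (simp add: arc_def distinct_map del: upt_Suc)
  have "(j + u) mod c < length C" for u using ij by (simp add: c_def[symmetric])
  then have arc_set: "set arc \<subseteq> set C" by (auto simp: arc_def)
  have arc_suc: "successively (\<lambda>x y. {x, y} \<in> E) arc"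
    unfolding successively_conv_nth
  proof (intro allI impI)
    fix t assume t: "Suc t < length arc"
    have m: "(j + t) mod c < length C" using ij by (simp add: c_def[symmetric])
    have "{C ! ((j + t) mod c), C ! (Suc ((j + t) mod c) mod c)} \<in> E"
      using cyc m unfolding is_cycle_def c_def by blast
    moreover have "Suc ((j + t) mod c) mod c = (j + Suc t) mod c" by (simp add: mod_Suc_eq)
    ultimately show "{arc ! t, arc ! Suc t} \<in> E"
      using t by (simp add: arc_def del: upt_Suc)
  qed
  have arc_hd: "hd arc = C ! j" using ij by (simp add: arc_def hd_map upt_conv_Cons del: upt_Suc)
  have arc_last: "last arc = C ! i" using d by (simp add: arc_def)
  have arc_ne: "arc \<noteq> []" by (simp add: arc_def)
  have setC: "set C \<subseteq> V" using cyc by (simp add: is_cycle_def)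
  have xs: "xs \<noteq> []" "distinct xs" "set xs \<subseteq> V - set C"
    "successively (\<lambda>x y. {x, y} \<in> E) xs"
    using assms(2) by (auto simp: graph_path_def)
  have "graph_path E V (arc @ xs)"
    using xs arc_dist arc_set arc_suc arc_ne arc_last setC assms(6)
    by (auto simp: graph_path_def successively_append_iff insert_commute)
  moreover have len: "length (arc @ xs) = Suc d + length xs" by (simp add: arc_def)
  moreover have "3 \<le> length (arc @ xs)" using len d xs by (cases xs) auto
  ultimately have "is_cycle V E (arc @ xs)"
    using assms(7) d xs arc_ne arc_hd by (intro is_cycle_of_path) auto
  then have "Suc d + length xs \<le> c" using max len by metis
  moreover have "cyc_dist c i j = c - d" using ij assms(5) by (auto simp: d_def cyc_dist_def)
  ultimately show ?thesis by (simp add: c_def)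
qed

text \<open>From each \<open>l\<close> in \<open>I\<close> lay out \<open>W l\<close> consecutive
  positions going forward. Each block stops before it reaches another member of \<open>I\<close>, so
  the blocks are disjoint and fit into the \<open>c\<close> positions.\<close>

lemma sum_gaps_le:
  assumes I: "I \<subseteq> {..<c}" and two: "2 \<le> card I"
    and gap: "\<And>l m. l \<in> I \<Longrightarrow> m \<in> I \<Longrightarrow> l \<noteq> m \<Longrightarrow> W l \<le> cyc_dist c l m"
  shows "(\<Sum>l\<in>I. W l) \<le> c"
proof -
  let ?P = "SIGMA l:I. {..<W l}"
  let ?f = "\<lambda>(l, u). if l + u < c then l + u else l + u - c"
  have finI: "finite I" using I finite_subset by blast
  \<comment> \<open>A second member of \<open>I\<close> keeps every \<open>W l\<close> below
    \<open>c\<close>; hence one subtraction of \<open>c\<close> in \<open>?f\<close> already reduces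
    modulo \<open>c\<close>.\<close>
  have Wc: "W l < c" if "l \<in> I" for l
  proof -
    have "\<exists>m\<in>I. m \<noteq> l"
    proof (rule ccontr)
      assume "\<not> ?thesis"
      then have "I \<subseteq> {l}" by blast
      then have "card I \<le> card {l}" by (meson card_mono finite.emptyI finite.insertI)
      with two show False by simp
    qed
    then obtain m where m: "m \<in> I" "m \<noteq> l" by blast
    then have "W l \<le> cyc_dist c l m" using gap that by blast
    also have "\<dots> < c" using m that I by (auto simp: cyc_dist_def)
    finally show ?thesis .
  qed
  have "inj_on ?f ?P"
  proof (rule inj_onI, clarify)
    fix l u m v
    assume a: "l \<in> I" "u < W l" "m \<in> I" "v < W m"
      "(if l + u < c then l + u else l + u - c) = (if m + v < c then m + v else m + v - c)"
    have b: "l < c" "m < c" "u < c" "v < c" using a I Wc[of l] Wc[of m] by auto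
    have "l = m"
    proof (rule ccontr)
      assume "l \<noteq> m"
      then have "u < cyc_dist c l m" "v < cyc_dist c m l" using gap[of l m] gap[of m l] a by auto
      with a(5) b \<open>l \<noteq> m\<close> show False by (auto simp: cyc_dist_def split: if_splits)
    qed
    with a(5) b show "l = m \<and> u = v" by (auto split: if_splits)
  qed
  moreover have "?f ` ?P \<subseteq> {..<c}"
  proof (rule image_subsetI)
    fix q assume "q \<in> ?P"
    then show "?f q \<in> {..<c}"
      using I Wc[of "fst q"] by (fastforce split: if_splits)
  qed
  ultimately have "card ?P \<le> card {..<c}" by (meson card_inj_on_le finite_lessThan)
  then show ?thesis using finI by (simp add: card_SigmaI)
qed

lemma cyc_dist_between:
  assumes "i < c" "l < c" "j < c" "l \<noteq> i" "i \<noteq> j" "l \<noteq> j" "cyc_dist c i l < cyc_dist c i j"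
  shows "cyc_dist c l j < cyc_dist c i j"
  using assms by (auto simp: cyc_dist_def split: if_splits)

text \<open>Finds a gap leading from \<open>X\<close> to \<open>Y\<close> with no marked position
  inside. A pair at least directed distance works: a member of \<open>Y\<close> inside the arc would
  be nearer to \<open>i\<close>, and from a member of \<open>X\<close> inside it the way to
  \<open>j\<close> would be shorter.\<close>

lemma closest_pair_gap:
  assumes "X \<subseteq> {..<c}" "Y \<subseteq> {..<c}" "X \<inter> Y = {}" "X \<noteq> {}" "Y \<noteq> {}"
  obtains i j where "i \<in> X" "j \<in> Y"
    "\<And>l. l \<in> X \<union> Y \<Longrightarrow> l \<noteq> i \<Longrightarrow> cyc_dist c i j \<le> cyc_dist c i l"
proof -
  obtain x y where "x \<in> X" "y \<in> Y" using assms(4,5) by auto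
  then obtain q where q: "fst q \<in> X" "snd q \<in> Y"
    and least: "\<And>r. fst r \<in> X \<Longrightarrow> snd r \<in> Y
      \<Longrightarrow> cyc_dist c (fst q) (snd q) \<le> cyc_dist c (fst r) (snd r)"
    using ex_has_least_nat[of "\<lambda>q. fst q \<in> X \<and> snd q \<in> Y" "(x, y)"
        "\<lambda>q. cyc_dist c (fst q) (snd q)"] by auto
  show ?thesis
  proof (rule that[OF q])
    fix l assume l: "l \<in> X \<union> Y" "l \<noteq> fst q"
    show "cyc_dist c (fst q) (snd q) \<le> cyc_dist c (fst q) l"
    proof (rule ccontr)
      assume less: "\<not> ?thesis"
      then have "l \<notin> Y" using least[of "(fst q, l)"] q by auto
      then have lX: "l \<in> X" using l by simp
      then have "cyc_dist c l (snd q) < cyc_dist c (fst q) (snd q)"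
        using less l q assms \<open>l \<notin> Y\<close> by (intro cyc_dist_between) auto
      with least[of "(l, snd q)"] lX q show False by simp
    qed
  qed
qed

definition positions :: "'a list \<Rightarrow> 'a set \<Rightarrow> nat set" where
  "positions C X = {i. i < length C \<and> C ! i \<in> X}"

lemma card_positions:
  assumes "distinct C" "X \<subseteq> set C"
  shows "card (positions C X) = card X"
proof -
  have "inj_on ((!) C) (positions C X)"
    using assms(1) by (auto simp: inj_on_def positions_def nth_eq_iff_index_eq)
  moreover have "(!) C ` positions C X = X"
    using assms(2) by (force simp: positions_def in_set_conv_nth image_iff)
  ultimately show ?thesis using card_image by metis
qed

lemma positions_lessThan: "positions C X \<subseteq> {..<length C}"
  by (auto simp: positions_def)

text \<open>Any two distinct vertices of \<open>A\<close> can serve, in either order, as attachment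
  points of the two ends of \<open>xs\<close>, so \<open>cycle_gap\<close> applies to each of the
  \<open>card A\<close> gaps.\<close>

lemma equal_end_neighbors_bound:
  assumes "longest_cycle V E C" "graph_path E (V - set C) xs"
    and "neighbors_in E (hd xs) (set C) = A" "neighbors_in E (last xs) (set C) = A"
    and "2 \<le> card A"
  shows "card A * (length xs + 1) \<le> length C"
proof -
  have dC: "distinct C" using assms(1) by (simp add: longest_cycle_def is_cycle_def)
  have cA: "card (positions C A) = card A"
    using assms(3) by (intro card_positions dC) (auto simp: neighbors_in_def)
  have "(\<Sum>l\<in>positions C A. length xs + 1) \<le> length C"
  proof (rule sum_gaps_le)
    fix l m assume "l \<in> positions C A" "m \<in> positions C A" "l \<noteq> m"
    then show "length xs + 1 \<le> cyc_dist (length C) l m"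
      using assms(3,4) by (intro cycle_gap[OF assms(1,2)]) (auto simp: positions_def neighbors_in_def)
  qed (use cA assms(5) in \<open>auto simp: positions_def\<close>)
  then show ?thesis using cA by simp
qed

text \<open>Once around \<open>C\<close>, the marked positions pass from \<open>A - B\<close> to
  \<open>B\<close> at least once, and back at least once. These two gaps have length at least
  \<open>length xs + 1\<close>, all others at least 2, and their sum is at most
  \<open>length C\<close>.\<close>

lemma end_neighbors_bound_aux:
  assumes "longest_cycle V E C" "graph_path E (V - set C) xs"
    and A: "neighbors_in E (hd xs) (set C) = A" and B: "neighbors_in E (last xs) (set C) = B"
    and "\<not> A \<subseteq> B" "B \<noteq> {}"
  shows "2 * length xs + 2 * card (A \<union> B) \<le> length C + 2"
proof -
  let ?c = "length C" and ?p = "length xs"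
  let ?I = "positions C (A \<union> B)" and ?X = "positions C (A - B)" and ?Y = "positions C B"
  have dC: "distinct C" using assms(1) by (simp add: longest_cycle_def is_cycle_def)
  have sub: "A \<subseteq> set C" "B \<subseteq> set C" using A B by (auto simp: neighbors_in_def)
  have cI: "card ?I = card (A \<union> B)" using dC sub by (intro card_positions) auto
  have XY: "?X \<union> ?Y = ?I" "?X \<inter> ?Y = {}" by (auto simp: positions_def)
  have neX: "?X \<noteq> {}" and neY: "?Y \<noteq> {}"
    using assms(5,6) sub by (fastforce simp: positions_def in_set_conv_nth)+
  have pre: "xs \<noteq> []" "set xs \<subseteq> V - set C" using assms(2) by (auto simp: graph_path_def)
  then have p1: "1 \<le> ?p" by (simp add: Suc_leI)
  \<comment> \<open>One-vertex paths give the gap of 2 between two neighbours of the same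
    end.\<close>
  have single: "graph_path E (V - set C) [x]" if "x \<in> set xs" for x
    using that pre by (auto simp: graph_path_def)
  have hl: "hd xs \<in> set xs" "last xs \<in> set xs" using pre by auto
  have gapAB: "?p + 1 \<le> cyc_dist ?c l m" if "l \<in> positions C A" "m \<in> positions C B" "l \<noteq> m" for l m
    using that A B by (intro cycle_gap[OF assms(1,2)]) (auto simp: positions_def neighbors_in_def)
  have gapBA: "?p + 1 \<le> cyc_dist ?c l m" if "l \<in> positions C B" "m \<in> positions C A" "l \<noteq> m" for l m
  proof -
    have "length (rev xs) + 1 \<le> cyc_dist ?c l m"
      using that A B pre
      by (intro cycle_gap[OF assms(1) graph_path_rev[OF assms(2)]])
        (auto simp: positions_def neighbors_in_def hd_rev last_rev)
    then show ?thesis by simp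
  qed
  have gapAA: "2 \<le> cyc_dist ?c l m" if "l \<in> positions C A" "m \<in> positions C A" "l \<noteq> m" for l m
    using that A cycle_gap[OF assms(1) single[OF hl(1)], of l m]
    by (auto simp: positions_def neighbors_in_def)
  have gapBB: "2 \<le> cyc_dist ?c l m" if "l \<in> positions C B" "m \<in> positions C B" "l \<noteq> m" for l m
    using that B cycle_gap[OF assms(1) single[OF hl(2)], of l m]
    by (auto simp: positions_def neighbors_in_def)
  have gap2: "2 \<le> cyc_dist ?c l m" if "l \<in> ?I" "m \<in> ?I" "l \<noteq> m" for l m
  proof -
    have "l \<in> positions C A \<or> l \<in> positions C B" "m \<in> positions C A \<or> m \<in> positions C B"
      using that by (auto simp: positions_def)
    then show ?thesis
      using gapAB[of l m] gapBA[of l m] gapAA[of l m] gapBB[of l m] that(3) p1 by linarith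
  qed
  have subA: "?X \<subseteq> positions C A" by (auto simp: positions_def)
  obtain i j where i: "i \<in> ?X" "j \<in> ?Y"
    and i_min: "\<And>l. l \<in> ?I \<Longrightarrow> l \<noteq> i \<Longrightarrow> cyc_dist ?c i j \<le> cyc_dist ?c i l"
    using closest_pair_gap[of ?X ?c ?Y] positions_lessThan XY neX neY by metis
  obtain i' j' where i': "i' \<in> ?Y" "j' \<in> ?X"
    and i'_min: "\<And>l. l \<in> ?I \<Longrightarrow> l \<noteq> i' \<Longrightarrow> cyc_dist ?c i' j' \<le> cyc_dist ?c i' l"
    using closest_pair_gap[of ?Y ?c ?X] positions_lessThan XY neX neY
    by (metis Int_commute Un_commute)
  have ne: "i \<noteq> j" "i' \<noteq> j'" "i \<noteq> i'" using i i' XY(2) by blast+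
  have iI: "i \<in> ?I" "i' \<in> ?I" using i i' XY(1) by blast+
  have finI: "finite ?I" by (simp add: positions_def)
  \<comment> \<open>\<open>i\<close> opens a gap from \<open>?X\<close> to \<open>?Y\<close> and
    \<open>i'\<close> one from \<open>?Y\<close> to \<open>?X\<close>, so these two receive the
    large weight.\<close>
  define W where "W l = (if l = i \<or> l = i' then ?p + 1 else 2)" for l
  have two: "2 \<le> card ?I"
    using card_mono[OF finI, of "{i, i'}"] iI ne by auto
  have "(\<Sum>l\<in>?I. W l) \<le> ?c"
  proof (rule sum_gaps_le[OF positions_lessThan two])
    fix l m assume lm: "l \<in> ?I" "m \<in> ?I" "l \<noteq> m"
    have "?p + 1 \<le> cyc_dist ?c i j" using gapAB i ne subA by blast
    moreover have "?p + 1 \<le> cyc_dist ?c i' j'" using gapBA i' ne subA by blast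
    ultimately show "W l \<le> cyc_dist ?c l m"
      using i_min[of m] i'_min[of m] gap2[OF lm] lm by (auto simp: W_def)
  qed
  moreover have "(\<Sum>l\<in>?I. W l) = (\<Sum>l\<in>{i, i'}. W l) + (\<Sum>l\<in>?I - {i, i'}. W l)"
    using finI iI by (subst sum.subset_diff[of "{i, i'}"]) auto
  moreover have "(\<Sum>l\<in>{i, i'}. W l) = 2 * (?p + 1)" using ne by (simp add: W_def)
  moreover have "(\<Sum>l\<in>?I - {i, i'}. W l) = (\<Sum>l\<in>?I - {i, i'}. 2)"
    by (intro sum.cong) (auto simp: W_def)
  moreover have "card (?I - {i, i'}) = card ?I - 2"
    using iI ne finI by (subst card_Diff_subset) auto
  ultimately have "2 * (?p + 1) + 2 * (card ?I - 2) \<le> ?c" by simp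
  then show ?thesis using two cI by simp
qed

text \<open>If the neighbour sets differ, the previous bound applies to \<open>xs\<close> or to its
  reversal. If they agree, the product bound is at least as strong, because \<open>card A\<close> is
  at least 2 and \<open>length xs\<close> at least 1, so that
  \<open>(card A - 2) * (length xs - 1)\<close> is nonnegative.\<close>

lemma end_neighbors_bound:
  assumes "longest_cycle V E C" "graph_path E (V - set C) xs"
    and A: "neighbors_in E (hd xs) (set C) = A" and B: "neighbors_in E (last xs) (set C) = B"
    and "A \<noteq> {}" "B \<noteq> {}" "2 \<le> card (A \<union> B)"
  shows "2 * length xs + 2 * card (A \<union> B) \<le> length C + 2"
proof -
  have ne: "xs \<noteq> []" using assms(2) by (simp add: graph_path_def)
  consider "\<not> A \<subseteq> B" | "\<not> B \<subseteq> A" | "A = B" by blast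
  then show ?thesis
  proof cases
    case 1
    then show ?thesis using end_neighbors_bound_aux[OF assms(1-4)] assms by blast
  next
    case 2
    have "2 * length (rev xs) + 2 * card (B \<union> A) \<le> length C + 2"
      using 2 assms ne
      by (intro end_neighbors_bound_aux[OF assms(1) graph_path_rev[OF assms(2)]])
        (auto simp: hd_rev last_rev)
    then show ?thesis by (simp add: Un_commute)
  next
    case 3
    then have le: "card A * (length xs + 1) \<le> length C"
      using assms by (intro equal_end_neighbors_bound[OF assms(1,2)]) auto
    obtain s where s: "card A = s + 2"
      using assms(7) 3 by (metis Un_absorb add.commute le_Suc_ex)
    obtain p where p: "length xs = Suc p" using ne by (cases xs) auto
    have "card (A \<union> B) = s + 2" using 3 s by simp
    then show ?thesis using le unfolding s p by (simp add: algebra_simps)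
  qed
qed

section \<open>Edge counting in a dense set outside the cycle\<close>

lemma card_ordered_edges:
  assumes "finite F" "\<And>e. e \<in> F \<Longrightarrow> card e = 2"
  shows "card {(x, y). {x, y} \<in> F} = 2 * card F"
proof -
  have eq: "card {(x, y). {x, y} = e} = 2 \<and> finite {(x, y). {x, y} = e}" if "e \<in> F" for e
  proof -
    have "card e = 2" using assms(2) that by blast
    then obtain a b where ab: "e = {a, b}" "a \<noteq> b" by (auto simp: card_2_iff)
    then have "{(x, y). {x, y} = e} = {(a, b), (b, a)}" by (auto simp: doubleton_eq_iff)
    then show ?thesis using ab by simp
  qed
  have "{(x, y). {x, y} \<in> F} = (\<Union>e\<in>F. {(x, y). {x, y} = e})" by auto
  then have "card {(x, y). {x, y} \<in> F} = (\<Sum>e\<in>F. card {(x, y). {x, y} = e})"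
    using assms(1) eq by (simp only:) (rule card_UN_disjoint, auto)
  also have "\<dots> = (\<Sum>e\<in>F. 2)" using eq by (intro sum.cong) auto
  finally show ?thesis by simp
qed

text \<open>The property \<open>dense\<close> is what minimality of \<open>D\<close> provides. On
  single vertices it is a degree bound; on sets of path ends it forces long chords.\<close>

locale dense_outside_cycle =
  fixes V :: "'a set" and E :: "'a set set" and C :: "'a list" and k :: nat and D :: "'a set"
  assumes graph: "simple_graph V E"
    and longest: "longest_cycle V E C"
    and k_def: "k = length C div 2"
    and k_ge: "2 \<le> k"
    and D_sub: "D \<subseteq> V - set C"
    and dense: "S \<subseteq> D \<Longrightarrow> S \<noteq> {} \<Longrightarrow>
      (k - 1) * card S < card {e \<in> E. e \<subseteq> D \<union> set C \<and> e \<inter> S \<noteq> {}}"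
begin

abbreviation dD :: "'a \<Rightarrow> nat" where "dD x \<equiv> card (neighbors_in E x D)"

abbreviation dC :: "'a \<Rightarrow> nat" where "dC x \<equiv> card (neighbors_in E x (set C))"

definition long_path :: "'a list \<Rightarrow> bool" where
  "long_path xs \<longleftrightarrow> graph_path E D xs \<and> (\<forall>ys. graph_path E D ys \<longrightarrow> length ys \<le> length xs)"

lemma finite_D: "finite D"
  using graph D_sub by (meson finite_Diff finite_subset simple_graph_def)

lemma finite_E: "finite E"
proof -
  have "E \<subseteq> Pow V" using graph by (auto simp: simple_graph_def)
  then show ?thesis using graph by (meson finite_Pow_iff finite_subset simple_graph_def)
qed

lemma card_edge: "e \<in> E \<Longrightarrow> card e = 2"
  using graph by (simp add: simple_graph_def)

lemma no_loop: "{x, y} \<in> E \<Longrightarrow> x \<noteq> y"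
  using card_edge by fastforce

lemma finite_neighbors [simp]: "finite (neighbors_in E x D)" "finite (neighbors_in E x (set C))"
  using finite_D by (auto simp: neighbors_in_def)

text \<open>Count ordered adjacent pairs in \<open>D\<close> that meet \<open>S\<close>. Those
  starting in \<open>S\<close> number at most \<open>card S * a\<close>; the others start in
  \<open>T - S\<close> and end in \<open>S\<close>. Each edge inside \<open>D\<close> is counted
  twice, and edges to \<open>C\<close> add at most \<open>card S * b\<close>.\<close>

lemma incident_edges_bound:
  assumes "S \<subseteq> T" "T \<subseteq> D"
    and bd: "\<And>x. x \<in> S \<Longrightarrow> neighbors_in E x D \<subseteq> T \<and> dD x \<le> a \<and> dC x \<le> b"
  shows "2 * card {e \<in> E. e \<subseteq> D \<union> set C \<and> e \<inter> S \<noteq> {}}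
    \<le> card S * a + (card T - card S) * card S + 2 * (card S * b)"
proof -
  let ?F = "{e \<in> E. e \<subseteq> D \<and> e \<inter> S \<noteq> {}}"
  let ?G = "\<Union>x\<in>S. (\<lambda>v. {x, v}) ` neighbors_in E x (set C)"
  have finT: "finite T" by (rule finite_subset[OF assms(2) finite_D])
  then have finS: "finite S" by (rule finite_subset[OF assms(1)])
  have "{e \<in> E. e \<subseteq> D \<union> set C \<and> e \<inter> S \<noteq> {}} \<subseteq> ?F \<union> ?G"
  proof
    fix e assume e: "e \<in> {e \<in> E. e \<subseteq> D \<union> set C \<and> e \<inter> S \<noteq> {}}"
    then obtain x where x: "x \<in> S" "x \<in> e" by blast
    have "card e = 2" using e card_edge by blast
    then obtain y where y: "e = {x, y}" using x by (auto simp: card_2_iff)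
    show "e \<in> ?F \<union> ?G" using e x y assms(1,2) by (auto simp: neighbors_in_def)
  qed
  then have "card {e \<in> E. e \<subseteq> D \<union> set C \<and> e \<inter> S \<noteq> {}} \<le> card (?F \<union> ?G)"
    using finite_E finS by (intro card_mono) auto
  also have "\<dots> \<le> card ?F + card ?G" by (rule card_Un_le)
  finally have 1: "card {e \<in> E. e \<subseteq> D \<union> set C \<and> e \<inter> S \<noteq> {}} \<le> card ?F + card ?G" .
  have "card ?G \<le> (\<Sum>x\<in>S. card ((\<lambda>v. {x, v}) ` neighbors_in E x (set C)))"
    using finS by (rule card_UN_le)
  also have "\<dots> \<le> (\<Sum>x\<in>S. b)"
    using bd by (intro sum_mono) (meson card_image_le finite_neighbors(2) le_trans)
  finally have 2: "card ?G \<le> card S * b" by simp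
  let ?N = "SIGMA x:S. neighbors_in E x D"
  have "{(x, y). {x, y} \<in> ?F} \<subseteq> ?N \<union> (T - S) \<times> S"
  proof (rule subrelI)
    fix x y assume "(x, y) \<in> {(x, y). {x, y} \<in> ?F}"
    then have xy: "{x, y} \<in> E" "{x, y} \<subseteq> D" "{x, y} \<inter> S \<noteq> {}" by auto
    show "(x, y) \<in> ?N \<union> (T - S) \<times> S"
    proof (cases "x \<in> S")
      case True
      then show ?thesis using xy by (auto simp: neighbors_in_def)
    next
      case False
      then have "y \<in> S" using xy(3) by auto
      moreover have "x \<in> neighbors_in E y D" using xy by (auto simp: neighbors_in_def insert_commute)
      ultimately show ?thesis using bd False by blast
    qed
  qed
  then have "card {(x, y). {x, y} \<in> ?F} \<le> card (?N \<union> (T - S) \<times> S)"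
    using finS finT by (intro card_mono) auto
  also have "\<dots> \<le> card ?N + card ((T - S) \<times> S)" by (rule card_Un_le)
  also have "card ?N \<le> (\<Sum>x\<in>S. a)"
    using finS bd by (simp add: card_SigmaI del: sum_constant) (intro sum_mono, blast)
  also have "card ((T - S) \<times> S) = (card T - card S) * card S"
    using assms(1) finS by (simp add: card_cartesian_product card_Diff_subset)
  finally have "card {(x, y). {x, y} \<in> ?F} \<le> card S * a + (card T - card S) * card S" by simp
  moreover have "card {(x, y). {x, y} \<in> ?F} = 2 * card ?F"
    using finite_E card_edge by (intro card_ordered_edges) auto
  ultimately show ?thesis using 1 2 by linarith
qed

text \<open>This is \<open>dense\<close> for the set \<open>{x}\<close>.\<close>

lemma degree_ge: "x \<in> D \<Longrightarrow> k \<le> dD x + dC x"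
proof -
  assume x: "x \<in> D"
  let ?N = "neighbors_in E x D \<union> neighbors_in E x (set C)"
  have "{e \<in> E. e \<subseteq> D \<union> set C \<and> e \<inter> {x} \<noteq> {}} \<subseteq> (\<lambda>v. {x, v}) ` ?N"
  proof
    fix e assume e: "e \<in> {e \<in> E. e \<subseteq> D \<union> set C \<and> e \<inter> {x} \<noteq> {}}"
    have "card e = 2" using e card_edge by blast
    then obtain y where y: "e = {x, y}" using e by (auto simp: card_2_iff)
    show "e \<in> (\<lambda>v. {x, v}) ` ?N" using e y by (auto simp: neighbors_in_def)
  qed
  then have "card {e \<in> E. e \<subseteq> D \<union> set C \<and> e \<inter> {x} \<noteq> {}} \<le> card ?N"
    by (meson card_image_le card_mono finite_UnI finite_imageI finite_neighbors le_trans)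
  also have "\<dots> \<le> dD x + dC x" by (rule card_Un_le)
  finally show ?thesis using dense[of "{x}"] x by simp
qed

section \<open>Longest paths in the dense set\<close>

lemma long_path_path: "long_path xs \<Longrightarrow> graph_path E (V - set C) xs"
  using D_sub by (auto simp: long_path_def graph_path_def)

lemma long_path_same_length:
  "long_path xs \<Longrightarrow> graph_path E D ys \<Longrightarrow> length ys = length xs \<Longrightarrow> long_path ys"
  by (simp add: long_path_def)

lemma long_path_rev: "long_path xs \<Longrightarrow> long_path (rev xs)"
  by (simp add: long_path_def graph_path_rev)

lemma long_path_exists:
  assumes "D \<noteq> {}"
  obtains xs where "long_path xs"
proof -
  obtain x where "x \<in> D" using assms by blast
  then have "graph_path E D [x]" by (simp add: graph_path_def)
  moreover have "\<forall>xs. graph_path E D xs \<longrightarrow> length xs < Suc (card D)"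
  proof (intro allI impI)
    fix xs assume "graph_path E D xs"
    then have "length xs = card (set xs)" "set xs \<subseteq> D"
      by (auto simp: graph_path_def distinct_card)
    then show "length xs < Suc (card D)" using card_mono[OF finite_D] by (simp add: le_imp_less_Suc)
  qed
  ultimately obtain xs where "graph_path E D xs"
    "\<forall>ys. graph_path E D ys \<longrightarrow> length ys \<le> length xs"
    using ex_has_greatest_nat[of "graph_path E D" "[x]" length "Suc (card D)"] by blast
  then show ?thesis using that by (auto simp: long_path_def)
qed

lemma long_path_hd_neighbors:
  assumes "long_path xs"
  shows "neighbors_in E (hd xs) D \<subseteq> set xs - {hd xs}"
proof
  fix y assume y: "y \<in> neighbors_in E (hd xs) D"
  have ne: "hd xs \<noteq> y" using y no_loop by (auto simp: neighbors_in_def)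
  have "y \<in> set xs"
  proof (rule ccontr)
    assume "y \<notin> set xs"
    then have "graph_path E D (y # xs)"
      using y assms
      by (auto simp: long_path_def graph_path_def neighbors_in_def successively_Cons insert_commute)
    then show False using assms by (force simp: long_path_def)
  qed
  then show "y \<in> set xs - {hd xs}" using ne by simp
qed

lemma long_path_dD_hd:
  assumes "long_path xs"
  shows "dD (hd xs) + 1 \<le> length xs"
proof -
  have ne: "xs \<noteq> []" "distinct xs" using assms by (auto simp: long_path_def graph_path_def)
  have "dD (hd xs) \<le> card (set xs - {hd xs})"
    using long_path_hd_neighbors[OF assms] by (intro card_mono) auto
  also have "\<dots> = length xs - 1" using ne by (simp add: distinct_card)
  finally show ?thesis using ne by (cases xs) auto
qed

lemma long_path_hd_mem: "long_path xs \<Longrightarrow> hd xs \<in> D \<and> last xs \<in> D \<and> xs \<noteq> []"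
  unfolding long_path_def graph_path_def using hd_in_set last_in_set by blast

text \<open>The gap bound gives \<open>length xs + card (A \<union> B) \<le> k + 1\<close>. Each end
  has at most \<open>length xs - 1\<close> neighbours in \<open>D\<close>, so its degree bound gives
  the reverse inequality with \<open>A\<close> or \<open>B\<close> alone. Hence equality holds
  throughout.\<close>

lemma two_attachments_eq:
  assumes "long_path xs"
    and A: "neighbors_in E (hd xs) (set C) = A" and B: "neighbors_in E (last xs) (set C) = B"
    and "A \<noteq> {}" "B \<noteq> {}" "2 \<le> card (A \<union> B)"
  shows "A = B" "card A + length xs = k + 1" "dD (hd xs) + 1 = length xs"
proof -
  have fin: "finite A" "finite B" using A B finite_neighbors by blast+
  have mem: "hd xs \<in> D" "last xs \<in> D" "xs \<noteq> []" using long_path_hd_mem[OF assms(1)] by auto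
  have "2 * length xs + 2 * card (A \<union> B) \<le> length C + 2"
    by (rule end_neighbors_bound[OF longest long_path_path[OF assms(1)] A B assms(4-6)])
  then have 1: "length xs + card (A \<union> B) \<le> k + 1" by (simp add: k_def)
  have 2: "dD (hd xs) + 1 \<le> length xs" by (rule long_path_dD_hd[OF assms(1)])
  have 3: "dD (last xs) + 1 \<le> length xs"
    using long_path_dD_hd[OF long_path_rev[OF assms(1)]] mem by (simp add: hd_rev)
  have 4: "k \<le> dD (hd xs) + card A" "k \<le> dD (last xs) + card B"
    using degree_ge mem A B by auto
  have 5: "card A \<le> card (A \<union> B)" "card B \<le> card (A \<union> B)"
    using fin by (auto intro: card_mono)
  have "card A = card (A \<union> B)" "card B = card (A \<union> B)" using 1 2 3 4 5 by linarith+
  then have "A = A \<union> B" "B = A \<union> B"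
    using fin by (meson Un_upper1 Un_upper2 card_subset_eq finite_UnI)+
  then show "A = B" by simp
  show "card A + length xs = k + 1" "dD (hd xs) + 1 = length xs" using 1 2 4 5 by linarith+
qed

text \<open>The exceptional lengths arise here. The equalities above and the product bound leave few
  values of \<open>card A\<close> and \<open>length xs\<close>; the one infinite family,
  \<open>card A = 2\<close> with at least three path vertices, has too few edges for
  \<open>dense\<close>.\<close>

lemma two_attachments_small:
  assumes "long_path xs"
    and A: "neighbors_in E (hd xs) (set C) = A" and B: "neighbors_in E (last xs) (set C) = B"
    and "A \<noteq> {}" "B \<noteq> {}" "2 \<le> card (A \<union> B)" "2 \<le> length xs"
  shows "length C \<in> {6, 7, 9}"
proof -
  note eq = two_attachments_eq[OF assms(1-6)]
  have gp: "graph_path E D xs" using assms(1) by (simp add: long_path_def)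
  then have dist: "distinct xs" and ne: "xs \<noteq> []" and sub: "set xs \<subseteq> D"
    by (auto simp: graph_path_def)
  have c: "length C \<le> 2 * k + 1" "2 * k \<le> length C" by (auto simp: k_def)
  have cA: "2 \<le> card A" using eq(1) assms(6) by simp
  have le: "card A * (length xs + 1) \<le> length C"
    using eq(1) A B cA by (intro equal_end_neighbors_bound[OF longest long_path_path[OF assms(1)]]) auto
  obtain s where s: "card A = s + 2" using cA by (metis add.commute le_Suc_ex)
  obtain q where q: "length xs = q + 2" using assms(7) by (metis add.commute le_Suc_ex)
  have kk: "k = s + q + 3" using eq(2) s q by simp
  \<comment> \<open>This is \<open>(s + 2) * (q + 3) \<le> 2 * (s + q + 3) + 1\<close>
    simplified.\<close>
  have "s * q + s \<le> 1" using le c(1) kk unfolding s q by (simp add: algebra_simps)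
  then consider "s = 0" | "s = 1" "q = 0" by (cases s; cases q) auto
  then show ?thesis
  proof cases
    case 2
    then have "k = 4" "9 \<le> length C" using kk le unfolding s q by auto
    then show ?thesis using c by auto
  next
    case 1
    show ?thesis
    proof (cases "q = 0")
      case True
      then have "k = 3" using kk 1 by simp
      then show ?thesis using c by auto
    next
      case False
      \<comment> \<open>The first vertex is adjacent to all others, so one rotation brings any
        vertex but the last to the front, and reversal brings the last. Thus every path vertex is an
        end of a longest path.\<close>
      have full: "neighbors_in E (hd xs) D = set xs - {hd xs}"
        using long_path_hd_neighbors[OF assms(1)] eq(3) ne dist
        by (intro card_subset_eq) (auto simp: distinct_card)
      have bd: "neighbors_in E y D \<subseteq> set xs \<and> dD y \<le> q + 1 \<and> dC y \<le> 2" if y: "y \<in> set xs" for y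
      proof -
        have "\<exists>ys. long_path ys \<and> hd ys = y \<and> set ys = set xs \<and> length ys = length xs
            \<and> (last ys = last xs \<or> last ys = hd xs)"
        proof (cases "y = last xs")
          case True
          then show ?thesis
            using long_path_rev[OF assms(1)] ne by (intro exI[of _ "rev xs"]) (auto simp: hd_rev last_rev)
        next
          case False
          obtain i where i: "i < length xs" "xs ! i = y" using y by (auto simp: in_set_conv_nth)
          have "i \<noteq> length xs - 1" using False i ne by (auto simp: last_conv_nth)
          then have i1: "0 < Suc i" "Suc i < length xs" using i by auto
          have "xs ! Suc i \<noteq> hd xs" using dist ne i1 by (simp add: hd_conv_nth nth_eq_iff_index_eq)
          then have "xs ! Suc i \<in> neighbors_in E (hd xs) D" using full i1 by simp
          then have "{hd xs, xs ! Suc i} \<in> E" by (simp add: neighbors_in_def)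
          note r = graph_path_rotate[OF gp i1 this]
          show ?thesis
            using r i(2) long_path_same_length[OF assms(1) r(1) r(5)]
            by (intro exI[of _ "rev (take (Suc i) xs) @ drop (Suc i) xs"]) simp
        qed
        then obtain ys where ys: "long_path ys" "hd ys = y" "set ys = set xs" "length ys = length xs"
          "last ys = last xs \<or> last ys = hd xs" by blast
        have dDy: "dD y \<le> q + 1" using long_path_dD_hd[OF ys(1)] ys q by simp
        have "k \<le> dD y + dC y" using degree_ge y sub by blast
        then have dCy: "2 \<le> dC y" using dDy kk 1 by simp
        have last: "neighbors_in E (last ys) (set C) = A" using ys(5) A B eq(1) by metis
        have "card (neighbors_in E y (set C)) \<le> card (neighbors_in E y (set C) \<union> A)"
          by (intro card_mono) (simp_all add: A[symmetric])
        then have "card (neighbors_in E y (set C)) + length ys = k + 1"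
          using dCy assms(4) last ys(1,2)
          by (intro two_attachments_eq(2)[of ys _ A]) auto
        then have "dC y \<le> 2" using ys q kk 1 by simp
        then show ?thesis using dDy long_path_hd_neighbors[OF ys(1)] ys by auto
      qed
      have cs: "card (set xs) = q + 2" using dist q by (simp add: distinct_card)
      \<comment> \<open>Here \<open>k - 1 = q + 2\<close>: more than
        \<open>(q + 2) * (q + 2)\<close> edges are required, but each of the \<open>q + 2\<close>
        vertices contributes at most \<open>(q + 1) / 2 + 2\<close>, which is too little once
        \<open>q\<close> is positive.\<close>
      have "2 * card {e \<in> E. e \<subseteq> D \<union> set C \<and> e \<inter> set xs \<noteq> {}}
          \<le> (q + 2) * (q + 1) + 2 * ((q + 2) * 2)"
        using incident_edges_bound[of "set xs" "set xs" "q + 1" 2] sub bd cs by simp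
      moreover have "(k - 1) * (q + 2) < card {e \<in> E. e \<subseteq> D \<union> set C \<and> e \<inter> set xs \<noteq> {}}"
        using dense[OF sub] ne cs by simp
      ultimately have "2 * ((q + 2) * (q + 2)) < (q + 2) * (q + 1) + 2 * ((q + 2) * 2)"
        using kk 1 by simp
      then have "q * q + q < 2" by (simp add: algebra_simps)
      then show ?thesis using False by (cases q) auto
    qed
  qed
qed

section \<open>Rotations with one end fixed\<close>

text \<open>Among longest paths with the given last vertex, take a chord from the first vertex that
  reaches farthest, to index \<open>t\<close>. Ends obtained by rotating the part before it have all
  their neighbours in \<open>D\<close> among these \<open>Suc t\<close> vertices;
  \<open>incident_edges_bound\<close> against \<open>dense\<close> then bounds \<open>t\<close> from
  below.\<close>

lemma long_chord_exists:
  assumes "long_path xs"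
    and bd: "\<And>ys. long_path ys \<Longrightarrow> last ys = last xs \<Longrightarrow> dC (hd ys) \<le> b \<and> 1 \<le> dD (hd ys)"
  obtains ys t where "graph_path E D ys" "t < length ys" "{hd ys, ys ! t} \<in> E"
    "2 * (k - 1) < Suc t + 2 * b"
proof -
  define Q where "Q t \<longleftrightarrow> (\<exists>ys. long_path ys \<and> last ys = last xs \<and> t < length ys
    \<and> {hd ys, ys ! t} \<in> E)" for t
  have neighbor_pos: "\<exists>t<length ys. ys ! t = v \<and> {hd ys, ys ! t} \<in> E"
    if "long_path ys" "v \<in> neighbors_in E (hd ys) D" for ys v
  proof -
    have "v \<in> set ys" using long_path_hd_neighbors that by blast
    then obtain t where "t < length ys" "ys ! t = v" by (auto simp: in_set_conv_nth)
    then show ?thesis using that(2) by (auto simp: neighbors_in_def)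
  qed
  have "neighbors_in E (hd xs) D \<noteq> {}" using bd[OF assms(1)] by auto
  then obtain t0 where "Q t0" using neighbor_pos[OF assms(1)] assms(1) unfolding Q_def by blast
  moreover have "\<forall>t. Q t \<longrightarrow> t \<le> length xs"
    using assms(1) by (force simp: Q_def long_path_def)
  ultimately obtain t where t: "Q t" and t_max: "\<And>u. Q u \<Longrightarrow> u \<le> t"
    using Nat.ex_has_greatest_nat[of Q t0 "length xs"] by blast
  obtain ys where ys: "long_path ys" "last ys = last xs" "t < length ys" "{hd ys, ys ! t} \<in> E"
    using t by (auto simp: Q_def)
  \<comment> \<open>\<open>t\<close> is an index, so the part cut off has \<open>Suc t\<close>
    vertices, the far endpoint of the chord included.\<close>
  define T where "T = set (take (Suc t) ys)"
  define suf where "suf = drop (Suc t) ys"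
  have ysd: "distinct ys" "set ys \<subseteq> D" "successively (\<lambda>x y. {x, y} \<in> E) ys"
    using ys(1) by (auto simp: long_path_def graph_path_def)
  have yss: "take (Suc t) ys @ suf = ys" by (simp add: suf_def)
  have cT: "card T = Suc t" using ysd(1) ys(3) by (simp add: T_def distinct_card)
  have TD: "T \<subseteq> D" using ysd(2) set_take_subset by (fastforce simp: T_def)
  have last_pre: "last (take (Suc t) ys) = ys ! t" using ys(3) by (simp add: take_Suc_conv_app_nth)
  have suf: "distinct suf" "set suf \<subseteq> D" "set suf \<inter> T = {}"
    "successively (\<lambda>x y. {x, y} \<in> E) suf" "suf \<noteq> [] \<Longrightarrow> {ys ! t, hd suf} \<in> E"
    "suf = [] \<Longrightarrow> last ys = ys ! t" "suf \<noteq> [] \<Longrightarrow> last ys = last suf"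
  proof -
    have d: "distinct (take (Suc t) ys @ suf)" "set (take (Suc t) ys @ suf) \<subseteq> D"
      "successively (\<lambda>x y. {x, y} \<in> E) (take (Suc t) ys @ suf)"
      using yss ysd by simp_all
    show "distinct suf" "set suf \<subseteq> D" "set suf \<inter> T = {}" using d by (auto simp: T_def)
    have ne: "take (Suc t) ys \<noteq> []" using ys(3) by auto
    show "successively (\<lambda>x y. {x, y} \<in> E) suf" "suf \<noteq> [] \<Longrightarrow> {ys ! t, hd suf} \<in> E"
      using d(3) ne last_pre unfolding successively_append_iff by auto
    show "suf = [] \<Longrightarrow> last ys = ys ! t" using yss last_pre by (metis append_Nil2)
    show "suf \<noteq> [] \<Longrightarrow> last ys = last suf" using yss by (metis last_appendR)
  qed
  \<comment> \<open>All rearrangements of the initial segment that keep its last vertex extend to longest paths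
    with the same last vertex, so by the choice of \<open>t\<close> their first vertices have all their
    neighbours in \<open>T\<close>.\<close>
  define Fam where "Fam qs \<longleftrightarrow> graph_path E D qs \<and> set qs = T \<and> last qs = ys ! t" for qs
  have Fam_len: "length qs = Suc t" if "Fam qs" for qs
    using that cT by (auto simp: Fam_def graph_path_def distinct_card)
  have Fam_long: "long_path (qs @ suf) \<and> last (qs @ suf) = last xs \<and> hd (qs @ suf) = hd qs"
    if F: "Fam qs" for qs
  proof -
    have "graph_path E D (qs @ suf)"
      using F suf unfolding Fam_def graph_path_def by (auto simp: successively_append_iff)
    moreover have "length (qs @ suf) = length ys"
      using Fam_len[OF F] ys(3) by (simp add: suf_def)
    ultimately have "long_path (qs @ suf)" using long_path_same_length[OF ys(1)] by blast
    moreover have "qs \<noteq> []" using F by (simp add: Fam_def graph_path_def)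
    ultimately show ?thesis using F suf(6,7) ys(2) by (auto simp: Fam_def last_append)
  qed
  have Fam_nb: "neighbors_in E (hd qs) D \<subseteq> T" if F: "Fam qs" for qs
  proof
    fix v assume v: "v \<in> neighbors_in E (hd qs) D"
    note long = Fam_long[OF F]
    obtain u where u: "u < length (qs @ suf)" "(qs @ suf) ! u = v"
      "{hd (qs @ suf), (qs @ suf) ! u} \<in> E"
      using neighbor_pos[of "qs @ suf" v] v long by auto
    then have "Q u" using long unfolding Q_def by blast
    then have "u < length qs" using t_max Fam_len[OF F] by (simp add: le_imp_less_Suc)
    then have "v \<in> set qs" using u(2) by (auto simp: nth_append)
    then show "v \<in> T" using F by (simp add: Fam_def)
  qed
  have "Fam (take (Suc t) ys)"
  proof -
    have "successively (\<lambda>x y. {x, y} \<in> E) (take (Suc t) ys)"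
      using ysd(3) yss by (metis successively_append_iff)
    then show ?thesis
      using ysd ys(3) last_pre TD by (auto simp: Fam_def graph_path_def T_def)
  qed
  moreover have "\<forall>qs. Fam qs \<longrightarrow> dD (hd qs) < Suc (card D)"
    using card_mono[OF finite_D, of "neighbors_in E _ D"]
    by (auto simp: neighbors_in_def less_Suc_eq_le)
  \<comment> \<open>Maximality of this degree bounds the degree in \<open>D\<close> of every end
    produced by a further rotation.\<close>
  ultimately obtain qs where F: "Fam qs" and q_max: "\<And>rs. Fam rs \<Longrightarrow> dD (hd rs) \<le> dD (hd qs)"
    using ex_has_greatest_nat[of Fam _ "\<lambda>qs. dD (hd qs)" "Suc (card D)"] by blast
  define a where "a = dD (hd qs)"
  \<comment> \<open>\<open>S\<close> collects the predecessors on \<open>qs\<close> of the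
    neighbours of \<open>hd qs\<close>, which are the ends reached by one rotation: one for each
    neighbour, so exactly \<open>a\<close> of them.\<close>
  define I where "I = {i. Suc i < length qs \<and> {hd qs, qs ! Suc i} \<in> E}"
  define S where "S = (!) qs ` I"
  have gp: "graph_path E D qs" and qs: "distinct qs" "qs \<noteq> []" "set qs \<subseteq> D" "set qs = T"
    using F by (auto simp: Fam_def graph_path_def)
  have "(\<lambda>i. qs ! Suc i) ` I = neighbors_in E (hd qs) D"
  proof
    show "(\<lambda>i. qs ! Suc i) ` I \<subseteq> neighbors_in E (hd qs) D"
      using qs(3) by (auto simp: I_def neighbors_in_def)
    show "neighbors_in E (hd qs) D \<subseteq> (\<lambda>i. qs ! Suc i) ` I"
    proof
      fix v assume v: "v \<in> neighbors_in E (hd qs) D"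
      then have "v \<in> set qs" "v \<noteq> hd qs"
        using Fam_nb[OF F] qs(4) no_loop by (auto simp: neighbors_in_def)
      then obtain j where j: "j < length qs" "qs ! j = v" by (auto simp: in_set_conv_nth)
      then have "j \<noteq> 0" using \<open>v \<noteq> hd qs\<close> qs(2) by (metis hd_conv_nth)
      then obtain i where "j = Suc i" using not0_implies_Suc by blast
      then show "v \<in> (\<lambda>i. qs ! Suc i) ` I" using j v by (auto simp: I_def neighbors_in_def)
    qed
  qed
  moreover have "inj_on (\<lambda>i. qs ! Suc i) I" "inj_on ((!) qs) I"
    using qs(1) by (auto simp: inj_on_def I_def nth_eq_iff_index_eq)
  ultimately have cS: "card S = a" unfolding S_def a_def by (metis card_image)
  have ST: "S \<subseteq> T" using qs(4) by (auto simp: S_def I_def)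
  have "neighbors_in E x D \<subseteq> T \<and> dD x \<le> a \<and> dC x \<le> b" if x: "x \<in> S" for x
  proof -
    obtain i where i: "Suc i < length qs" "{hd qs, qs ! Suc i} \<in> E" "x = qs ! i"
      using x by (auto simp: S_def I_def)
    let ?rs = "rev (take (Suc i) qs) @ drop (Suc i) qs"
    note r = graph_path_rotate[OF gp zero_less_Suc i(1,2)]
    have R: "Fam ?rs" using r F by (simp add: Fam_def del: set_append)
    have hd: "hd ?rs = x" using r(2) i(3) by simp
    show ?thesis using Fam_nb[OF R] q_max[OF R] bd[of "?rs @ suf"] Fam_long[OF R] hd
      by (simp add: a_def)
  qed
  then have "2 * card {e \<in> E. e \<subseteq> D \<union> set C \<and> e \<inter> S \<noteq> {}}
      \<le> a * a + (Suc t - a) * a + 2 * (a * b)"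
    using incident_edges_bound[OF ST TD, of a b] cS cT by simp
  moreover have a1: "1 \<le> a" using bd[of "qs @ suf"] Fam_long[OF F] by (simp add: a_def)
  moreover have "a \<le> Suc t"
    using card_mono[OF _ ST] cS cT finite_D TD finite_subset by metis
  then have "a * a + (Suc t - a) * a = a * Suc t"
    by (metis add_mult_distrib le_add_diff_inverse mult.commute)
  moreover have "(k - 1) * a < card {e \<in> E. e \<subseteq> D \<union> set C \<and> e \<inter> S \<noteq> {}}"
    using dense[of S] ST TD cS a1 by fastforce
  \<comment> \<open>Since \<open>card S = a\<close>, both sides are multiples of the positive number
    \<open>a\<close>, which cancels.\<close>
  ultimately have "2 * ((k - 1) * a) < a * Suc t + 2 * (a * b)" by linarith
  then have "a * (2 * (k - 1)) < a * (Suc t + 2 * b)" by (simp only: algebra_simps)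
  then have "2 * (k - 1) < Suc t + 2 * b" by (simp only: mult_less_cancel1)
  with that ys show ?thesis unfolding long_path_def by blast
qed

text \<open>Two neighbours on \<open>C\<close> of one outside vertex are never consecutive: this is
  the equal-neighbour bound for a one-vertex path.\<close>

lemma dC_le: "x \<in> D \<Longrightarrow> dC x \<le> k"
proof (cases "2 \<le> dC x")
  case True
  assume "x \<in> D"
  then have "dC x * (length [x] + 1) \<le> length C"
    using True D_sub by (intro equal_end_neighbors_bound[OF longest]) (auto simp: graph_path_def)
  then show ?thesis by (simp add: k_def)
qed (use k_ge in simp)

section \<open>Constructing the second cycle\<close>

lemma almost_disjoint_cycle:
  assumes "D \<noteq> {}" "\<And>u. u \<in> D \<Longrightarrow> dC u \<noteq> k" "length C \<notin> {6, 7, 9}"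
  shows "\<exists>C'. is_cycle V E C' \<and> card (set C \<inter> set C') \<le> 1
          \<and> (set C \<inter> set C' = {} \<longrightarrow> length C' \<ge> 2 * k - 3)
          \<and> (card (set C \<inter> set C') = 1 \<longrightarrow> length C' \<ge> 2 * k - 1)"
proof -
  \<comment> \<open>With fewer than \<open>k\<close> neighbours on \<open>C\<close>, each vertex of
    \<open>D\<close> has one in \<open>D\<close>, so longest paths have at least two
    vertices.\<close>
  have dD_pos: "1 \<le> dD u" if "u \<in> D" for u
    using degree_ge[OF that] dC_le[OF that] assms(2)[OF that] by linarith
  have len: "2 \<le> length xs" if "long_path xs" for xs
    using long_path_dD_hd[OF that] dD_pos long_path_hd_mem[OF that] by fastforce
  let ?A = "\<lambda>x. neighbors_in E x (set C)"
  have small: "card (?A (hd xs) \<union> ?A (last xs)) \<le> 1"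
    if "long_path xs" "?A (hd xs) \<noteq> {}" "?A (last xs) \<noteq> {}" for xs
    using two_attachments_small[OF that(1) refl refl that(2,3)] len[OF that(1)] assms(3) by linarith
  show ?thesis
  \<comment> \<open>For \<open>k = 2\<close> a cycle meeting \<open>C\<close> in one vertex needs
    only \<open>2 * k - 1 = 3\<close> vertices: the common neighbour of both ends and the path
    itself.\<close>
  proof (cases "k = 2 \<and> (\<exists>xs. long_path xs \<and> ?A (hd xs) \<noteq> {} \<and> ?A (last xs) \<noteq> {})")
    case True
    then obtain xs where xs: "long_path xs" "?A (hd xs) \<noteq> {}" "?A (last xs) \<noteq> {}" by blast
    obtain v w where vw: "v \<in> ?A (hd xs)" "w \<in> ?A (last xs)" using xs by blast
    have "v = w" using small[OF xs] vw by (auto simp: card_le_Suc0_iff_eq)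
    have v: "v \<in> set C" "{hd xs, v} \<in> E" "{last xs, v} \<in> E"
      using vw \<open>v = w\<close> by (auto simp: neighbors_in_def)
    have p: "graph_path E (V - set C) xs" by (rule long_path_path[OF xs(1)])
    have "set C \<subseteq> V" using longest by (simp add: longest_cycle_def is_cycle_def)
    then have "graph_path E V (v # xs)"
      using p v by (auto simp: graph_path_def successively_Cons insert_commute)
    then have "is_cycle V E (v # xs)"
      using v len[OF xs(1)] p by (intro is_cycle_of_path) (auto simp: graph_path_def)
    moreover have "set C \<inter> set (v # xs) = {v}" using p v by (auto simp: graph_path_def)
    moreover have "2 * k - 1 \<le> length (v # xs)" using len[OF xs(1)] True by simp
    ultimately show ?thesis by (intro exI[of _ "v # xs"]) simp
  next
    case False
    \<comment> \<open>The chord will give \<open>Suc t \<ge> 2 * k - 1 - 2 * b\<close>. For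
      \<open>k = 2\<close> only \<open>b = 0\<close> makes this 3, the least length of a cycle; for
      larger \<open>k\<close>, \<open>b = 1\<close> suffices.\<close>
    have "\<exists>xs b. long_path xs \<and> b \<le> 1 \<and> (k = 2 \<longrightarrow> b = 0)
      \<and> (\<forall>ys. long_path ys \<longrightarrow> last ys = last xs \<longrightarrow> dC (hd ys) \<le> b)"
    proof (cases "\<exists>xs. long_path xs \<and> ?A (last xs) \<noteq> {}")
      case True
      \<comment> \<open>Fix an end attached to \<open>C\<close>. By \<open>small\<close>, any
        opposite end that is also attached has with it just one neighbour on \<open>C\<close>
        altogether.\<close>
      then obtain xs where xs: "long_path xs" "?A (last xs) \<noteq> {}" by blast
      have "dC (hd ys) \<le> (if k = 2 then 0 else 1)" if ys: "long_path ys" "last ys = last xs" for ys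
      proof (cases "?A (hd ys) = {}")
        case True
        then show ?thesis by simp
      next
        case nonempty: False
        have "dC (hd ys) \<le> card (?A (hd ys) \<union> ?A (last ys))" by (intro card_mono) auto
        also have "\<dots> \<le> 1" using small[OF ys(1) nonempty] ys(2) xs(2) by simp
        finally show ?thesis using False nonempty ys xs(2) by auto
      qed
      then show ?thesis using xs(1) by (intro exI[of _ xs] exI[of _ "if k = 2 then 0 else 1"]) simp
    next
      case none: False
      obtain xs where xs: "long_path xs" using long_path_exists[OF assms(1)] .
      have "dC (hd ys) = 0" if "long_path ys" for ys
      proof -
        have "last (rev ys) = hd ys" using long_path_hd_mem[OF that] by (simp add: last_rev)
        then have "?A (hd ys) = {}" using none long_path_rev[OF that] by metis
        then show ?thesis by simp
      qed
      then show ?thesis using xs by auto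
    qed
    then obtain xs b where xs: "long_path xs" and b: "b \<le> 1" "k = 2 \<longrightarrow> b = 0"
      and bd: "\<And>ys. long_path ys \<Longrightarrow> last ys = last xs \<Longrightarrow> dC (hd ys) \<le> b" by blast
    obtain ys t where ys: "graph_path E D ys" "t < length ys" "{hd ys, ys ! t} \<in> E"
      and t: "2 * (k - 1) < Suc t + 2 * b"
      using long_chord_exists[OF xs, of b] bd dD_pos long_path_hd_mem by metis
    have T: "3 \<le> Suc t" "2 * k - 3 \<le> Suc t" using t b k_ge by (auto simp: le_Suc_eq)
    \<comment> \<open>The chord closes these vertices to a cycle inside \<open>D\<close>, hence
      disjoint from \<open>C\<close>.\<close>
    let ?zs = "take (Suc t) ys"
    have "successively (\<lambda>x y. {x, y} \<in> E) ?zs"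
      using ys(1) unfolding graph_path_def by (metis append_take_drop_id successively_append_iff)
    moreover have sub: "set ?zs \<subseteq> D"
      using ys(1) set_take_subset[of "Suc t" ys] by (auto simp: graph_path_def)
    ultimately have "graph_path E V ?zs"
      using ys D_sub by (auto simp: graph_path_def)
    moreover have "last ?zs = ys ! t" "hd ?zs = hd ys" "length ?zs = Suc t"
      using ys(2) by (auto simp: take_Suc_conv_app_nth hd_append hd_conv_nth nth_append)
    ultimately have "is_cycle V E ?zs"
      using ys(3) T by (intro is_cycle_of_path) (auto simp: insert_commute)
    moreover have "set C \<inter> set ?zs = {}" using sub D_sub by blast
    ultimately show ?thesis using T ys(2) by (intro exI[of _ ?zs]) simp
  qed
qed

end

section \<open>Passing to a minimal dense set\<close>

theorem theorem3p2:
  fixes V :: "'a set" and E :: "'a set set" and C :: "'a list" and n c :: nat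
  assumes "simple_graph V E"
    and "n = card V"
    and "longest_cycle V E C"
    and "c = length C"
    and "4 \<le> c" and "c \<le> n - 1"
    and "card (edges_within E (V - set C)) + card (edges_between E (V - set C) (set C))
           > (c div 2 - 1) * (n - c)"
  shows "c \<in> {6, 7, 9}
    \<or> (\<exists>u \<in> V - set C. card (neighbors_in E u (set C)) = c div 2)
    \<or> (\<exists>C'. is_cycle V E C' \<and> card (set C \<inter> set C') \<le> 1
          \<and> (set C \<inter> set C' = {} \<longrightarrow> length C' \<ge> 2 * (c div 2) - 3)
          \<and> (card (set C \<inter> set C') = 1 \<longrightarrow> length C' \<ge> 2 * (c div 2) - 1))"
proof (rule ccontr)
  assume neg: "\<not> ?thesis"
  define k where "k = c div 2"
  define inc where "inc D S = {e \<in> E. e \<subseteq> D \<union> set C \<and> e \<inter> S \<noteq> {}}" for D S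
  have edges: "\<And>e. e \<in> E \<Longrightarrow> e \<subseteq> V \<and> card e = 2" and finV: "finite V"
    using assms(1) by (auto simp: simple_graph_def)
  then have "E \<subseteq> Pow V" by blast
  then have finE: "finite E" using finV finite_subset by blast
  have C: "distinct C" "set C \<subseteq> V" using assms(3) by (auto simp: longest_cycle_def is_cycle_def)
  have "edges_within E (V - set C) \<union> edges_between E (V - set C) (set C)
      \<subseteq> inc (V - set C) (V - set C)"
  proof (rule subsetI)
    fix e assume e: "e \<in> edges_within E (V - set C) \<union> edges_between E (V - set C) (set C)"
    then have "e \<in> E" by (auto simp: edges_within_def edges_between_def)
    then have "e \<noteq> {}" using edges[of e] by auto
    with e show "e \<in> inc (V - set C) (V - set C)"
      by (auto simp: edges_within_def edges_between_def inc_def)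
  qed
  then have "card (edges_within E (V - set C) \<union> edges_between E (V - set C) (set C))
      \<le> card (inc (V - set C) (V - set C))"
    using finE by (intro card_mono) (auto simp: inc_def)
  moreover have "edges_within E (V - set C) \<inter> edges_between E (V - set C) (set C) = {}"
    by (auto simp: edges_within_def edges_between_def)
  then have "card (edges_within E (V - set C) \<union> edges_between E (V - set C) (set C))
      = card (edges_within E (V - set C)) + card (edges_between E (V - set C) (set C))"
    using finE by (intro card_Un_disjoint) (auto simp: edges_within_def edges_between_def)
  moreover have "card (V - set C) = n - c"
    using C assms(2,4) by (simp add: card_Diff_subset distinct_card)
  ultimately have start: "(k - 1) * card (V - set C) < card (inc (V - set C) (V - set C))"
    using assms(7) by (simp add: k_def)
  \<comment> \<open>\<open>P\<close> holds for \<open>V - set C\<close> by the assumed edge count; a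
    member of least size has the property required of \<open>D\<close> in the locale.\<close>
  define P where "P D \<longleftrightarrow> D \<subseteq> V - set C \<and> (k - 1) * card D < card (inc D D)" for D
  obtain D where D: "P D" and D_min: "\<And>D'. P D' \<Longrightarrow> card D \<le> card D'"
    using ex_has_least_nat[of P "V - set C" card] start by (auto simp: P_def)
  have finD: "finite D" using D finV finite_subset unfolding P_def by blast
  have "dense_outside_cycle V E C k D"
  proof
    show "simple_graph V E" "longest_cycle V E C" "k = length C div 2" "2 \<le> k" "D \<subseteq> V - set C"
      using assms D by (auto simp: k_def P_def)
    fix S assume S: "S \<subseteq> D" "S \<noteq> {}"
    have finS: "finite S" using S finD finite_subset by blast
    have cD: "card D = card (D - S) + card S"
      using S finS finD by (metis Diff_partition card_Un_disjoint Diff_disjoint add.commute finite_Diff)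
    have "card S > 0" using S finS by (simp add: card_gt_0_iff)
    then have "\<not> P (D - S)" using D_min[of "D - S"] cD by linarith
    then have "card (inc (D - S) (D - S)) \<le> (k - 1) * card (D - S)" using D by (auto simp: P_def)
    \<comment> \<open>An edge counted for \<open>D\<close> either meets \<open>S\<close>, or misses
      it and is counted for \<open>D - S\<close>, where by minimality there are few.\<close>
    moreover have "inc D D \<subseteq> inc (D - S) (D - S) \<union> inc D S" by (auto simp: inc_def)
    then have "card (inc D D) \<le> card (inc (D - S) (D - S) \<union> inc D S)"
      using finE by (intro card_mono) (auto simp: inc_def)
    then have "card (inc D D) \<le> card (inc (D - S) (D - S)) + card (inc D S)"
      using card_Un_le le_trans by blast
    moreover have "(k - 1) * card (D - S) + (k - 1) * card S < card (inc D D)"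
      using D cD by (simp add: P_def add_mult_distrib2)
    ultimately show "(k - 1) * card S < card {e \<in> E. e \<subseteq> D \<union> set C \<and> e \<inter> S \<noteq> {}}"
      by (simp add: inc_def)
  qed
  then interpret dense_outside_cycle V E C k D .
  have "D \<noteq> {}" using D by (auto simp: P_def inc_def)
  from almost_disjoint_cycle[OF this] neg D_sub show False
    unfolding k_def assms(4) by blast
qed

end
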